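(* Let $1\le k\le n$ be integers, let $X=T^*Gr(k,n)$, and let $\mathbf p=\{p_1<\dots<p_k\}\subset\{1,\dots,n\}$ be a torus fixed point of $X$, with vertex function $$ \mathbf V_{\mathbf p}(a_1,\dots,a_n,z)=\sum_{d_1,\dots,d_k=0}^{\infty}\left(\prod_{i=1}^n\prod_{j=1}^k\frac{(\hbar a_i/a_{p_j})_{d_j}}{(q a_i/a_{p_j})_{d_j}}\prod_{i,j=1}^k\frac{(q a_{p_j}/a_{p_i})_{d_i-d_j}}{(\hbar a_{p_j}/a_{p_i})_{d_i-d_j}}\right)z^{d_1+\dots+d_k}. $$ Let $\mathbf V_{\mathbf p}(0_{\mathfrak C},z)=\lim_{w\to0}\mathbf V_{\mathbf p}(w^{-1},w^{-2},\dots,w^{-n},z)$, the limit being taken coefficientwise in $z$. Then, as power series in $z$, $$ \mathbf V_{\mathbf p}(0_{\mathfrak C},z)=\prod_{i=1}^k\xi\left(\hbar,\left(\frac{\hbar}{q}\right)^{n-k-p_i+2i-1}z\right). $$ Moreover, if $n\ge 2k$, let $X'$ be the 3d mirror of $X$, let $\lambda$ be the fixed point of $X'$ corresponding to $\mathbf p$, and let $N'^-_\lambda$ be the repelling part of the tangent space $T_\lambda X'$, with $\mathsf T'$-character $$ N'^-_\lambda=\sum_{i=1}^k\frac{a_2'}{a_1'}(\hbar')^{-2k+n-p_i+2i}. $$ Then, with $\kappa^*$ denoting the substitution $z\mapsto \frac{a_1'}{a_2'}(\hbar')^{k-1}$, $\hbar\mapsto q/\hbar'$, $$ \kappa^*\big(\mathbf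 V_{\mathbf p}(0_{\mathfrak C},z)\big)=\Xi\big(q/\hbar',(N'^-_\lambda)^*\big) $$ as power series in $a'=a_1'/a_2'$.
   Context: Here $q$ is a fixed complex number with $0<|q|<1$, and $\hbar,a_1,\dots,a_n,z$ (respectively $\hbar',a_1',a_2'$) are independent variables; $\mathbf V_{\mathbf p}$ is a formal power series in $z$ with coefficients rational in $a_1,\dots,a_n,\hbar,q$. Notation. $\varphi(w)=\prod_{m=0}^\infty(1-wq^m)$. For $d\in\mathbb Z$, $$(a)_d=\frac{\varphi(a)}{\varphi(aq^d)}=\begin{cases}(1-a)(1-aq)\cdots(1-aq^{d-1}), & d\ge0,\\ \dfrac{1}{(1-aq^{d})\cdots(1-aq^{-1})}, & d<0.\end{cases}$$ Set $\xi(b,w)=\varphi(bw)/\varphi(w)$, regarded as its Taylor series in $w$. For a sum of monomials (a character) $N=w_1+\dots+w_m$ put $\Xi(b,N)=\xi(b,w_1)\cdots\xi(b,w_m)$. The dual $N^*=w_1^{-1}+\dots+w_m^{-1}$ has the inverse weights. Geometric setting. $X=T^*Gr(k,n)$ carries the action of $\mathsf T=(\mathbb C^\times)^n\times\mathbb C^\times_\hbar$ (equivariant parameters $a_1,\dots,a_n,\hbar$); its fixed points are labeled by $k$-element subsets $\mathbf p\subset\{1,\dots,n\}$, and $\mathbf V_{\mathbf p}$ is the component at $\mathbf p$ of the $K$-theoretic vertex function (equivariant count of quasimaps from $\mathbb P^1$ to $X$), given explicitly by the series in the claim. The substitution $a_i=w^{-i}$, $w\to0$, is the limit along a cocharacter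 in the chamber $\mathfrak C$ for which $a_i/a_j\to0$ when $i<j$. For $n\ge2k$, $X'$ is the Nakajima quiver variety of the $A_{n-1}$ quiver with dimension vector $(1,2,\dots,k-1,k,\dots,k,k-1,\dots,2,1)$ and one-dimensional framings at vertices $k$ and $n-k$, with torus $\mathsf T'$ having coordinates $a_1',a_2'$ (framing torus) and $\hbar'$. Its fixed points are labeled by Young diagrams $\lambda$ in an $(n-k)\times k$ rectangle; the boundary of $\lambda$ is a path of $n$ unit segments, of which $k$ are vertical, and $\lambda$ corresponds to the subset $\mathbf p\subset\{1,\dots,n\}$ of positions of the vertical segments. The repelling part $N'^-_\lambda$ of $T_\lambda X'$ is taken with respect to the cocharacter $w\mapsto(a_1',a_2')=(1,w^{-1})$, so it is the part with negative powers of $a_1'/a_2'$; its $\mathsf T'$-character is the one displayed in the claim, which may be taken as its definition. *)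

theory Defs
  imports "HOL-Complex_Analysis.Complex_Analysis"
begin

definition qphi :: "complex \<Rightarrow> complex \<Rightarrow> complex" where
  "qphi q w = (\<Prod>m. 1 - w * q ^ m)"

text \<open>
  The symbol \<open>(a)\<^sub>d\<close> for an integer \<open>d\<close>. The finite products are used as the definition, because
  they also make sense where the quotient \<open>qphi q a / qphi q (a q\<^sup>d)\<close> is \<open>0/0\<close>;
  the agreement with the quotient is \<open>qpoch_eq_qphi_ratio\<close> below.
\<close>
definition qpoch :: "complex \<Rightarrow> complex \<Rightarrow> int \<Rightarrow> complex" where
  "qpoch q a d =
     (if d \<ge> 0 then (\<Prod>m<nat d. 1 - a * q ^ m)
      else 1 / (\<Prod>m=1..nat (- d). 1 - a * q powi (- int m)))"

lemma convergent_prod_qphi: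
  assumes "norm q < 1"
  shows "convergent_prod (\<lambda>m. 1 - w * q ^ m :: complex)"
proof -
  have "summable (\<lambda>m. norm (w * q ^ m))"
    using assms by (simp add: norm_mult norm_power summable_geometric summable_mult)
  hence "abs_convergent_prod (\<lambda>m. 1 - w * q ^ m)"
    by (simp add: abs_convergent_prod_conv_summable)
  thus ?thesis
    by (rule abs_convergent_prod_imp_convergent_prod)
qed

lemma qphi_rec:
  assumes "norm q < 1"
  shows "qphi q w = (1 - w) * qphi q (w * q)"
proof -
  have 1: "(\<lambda>n. \<Prod>i\<le>n. 1 - w * q ^ i) \<longlonglongrightarrow> qphi q w"
    unfolding qphi_def by (intro convergent_prod_LIMSEQ convergent_prod_qphi assms)
  have 2: "(\<lambda>n. \<Prod>i\<le>n. 1 - w * q * q ^ i) \<longlonglongrightarrow> qphi q (w * q)"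
    unfolding qphi_def by (intro convergent_prod_LIMSEQ convergent_prod_qphi assms)
  have "(\<lambda>n. \<Prod>i\<le>Suc n. 1 - w * q ^ i) \<longlonglongrightarrow> (1 - w) * qphi q (w * q)"
    using tendsto_mult_left[OF 2, of "1 - w"]
    by (subst prod.atMost_Suc_shift) (simp add: mult.assoc)
  with LIMSEQ_Suc[OF 1] show ?thesis
    using LIMSEQ_unique by blast
qed

lemma qphi_split:
  assumes "norm q < 1"
  shows "qphi q w = (\<Prod>m<n. 1 - w * q ^ m) * qphi q (w * q ^ n)"
proof (induction n)
  case (Suc n)
  have "qphi q (w * q ^ n) = (1 - w * q ^ n) * qphi q (w * q ^ Suc n)"
    using qphi_rec[OF assms, of "w * q ^ n"] by (simp add: mult_ac)
  with Suc show ?case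
    by (simp add: mult_ac)
qed auto

lemma qpoch_eq_qphi_ratio:
  assumes "q \<noteq> 0" "norm q < 1" "qphi q (a * q powi d) \<noteq> 0"
  shows "qpoch q a d = qphi q a / qphi q (a * q powi d)"
proof (cases "d \<ge> 0")
  case True
  then obtain n where "d = int n"
    by (metis nonneg_int_cases)
  thus ?thesis
    using assms(3) qphi_split[OF assms(2), of a n] by (simp add: qpoch_def)
next
  case False
  define n where "n = nat (- d)"
  have d: "d = - int n" and n: "n > 0"
    using False by (auto simp: n_def)
  define b where "b = a * q powi d"
  have a: "b * q ^ n = a"
    using assms(1) by (simp add: b_def d power_int_minus)
  have "(\<Prod>m=1..n. 1 - a * q powi (- int m)) = (\<Prod>m<n. 1 - b * q ^ m)"
  proof (rule prod.reindex_bij_witness[of _ "\<lambda>m. n - m" "\<lambda>m. n - m"])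
    fix m assume "m \<in> {1..n}"
    hence "q ^ n = q ^ (n - m) * q ^ m"
      by (simp flip: power_add)
    thus "1 - b * q ^ (n - m) = 1 - a * q powi (- int m)"
      using assms(1) a by (auto simp: power_int_minus field_simps)
  qed (use n in auto)
  moreover have "qphi q b = (\<Prod>m<n. 1 - b * q ^ m) * qphi q a"
    using qphi_split[OF assms(2), of b n] a by simp
  moreover have "qpoch q a d = 1 / (\<Prod>m=1..n. 1 - a * q powi (- int m))"
    using False by (simp add: qpoch_def n_def)
  moreover have "qphi q b \<noteq> 0"
    using assms(3) by (simp add: b_def)
  ultimately show ?thesis
    by (simp add: b_def[symmetric])
qed

text \<open>
  \<open>\<xi>(b, w)\<close> for a formal power series \<open>w\<close> without constant term: the Taylor series at \<open>0\<close> of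
  \<open>u \<mapsto> \<phi>(b u) / \<phi>(u)\<close>, with \<open>w\<close> substituted for \<open>u\<close>.
\<close>
definition xi :: "complex \<Rightarrow> complex \<Rightarrow> complex fps \<Rightarrow> complex fps" where
  "xi q b w = fps_compose (fps_expansion (\<lambda>u. qphi q (b * u) / qphi q u) 0) w"

text \<open>The element \<open>p\<^sub>i\<close> (with \<open>i\<close> counted from \<open>1\<close>) of \<open>p = {p\<^sub>1 < \<dots> < p\<^sub>k}\<close>.\<close>
definition elt :: "nat set \<Rightarrow> nat \<Rightarrow> nat" where
  "elt p i = sorted_list_of_set p ! (i - 1)"

definition vertex_term ::
  "complex \<Rightarrow> complex \<Rightarrow> nat \<Rightarrow> nat \<Rightarrow> nat set \<Rightarrow> (nat \<Rightarrow> complex) \<Rightarrow> (nat \<Rightarrow> nat) \<Rightarrow> complex" where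
  "vertex_term q h n k p a d =
     (\<Prod>i=1..n. \<Prod>j=1..k.
        qpoch q (h * a i / a (elt p j)) (int (d j)) /
        qpoch q (q * a i / a (elt p j)) (int (d j))) *
     (\<Prod>i=1..k. \<Prod>j=1..k.
        qpoch q (q * a (elt p j) / a (elt p i)) (int (d i) - int (d j)) /
        qpoch q (h * a (elt p j) / a (elt p i)) (int (d i) - int (d j)))"

text \<open>
  The vertex function as a power series in \<open>z\<close>, at numerical values of \<open>\<hbar>\<close> (written \<open>h\<close>) and of the \<open>a\<^sub>i\<close>.
  The multi-indices \<open>(d\<^sub>1, \<dots>, d\<^sub>k)\<close> are extensional functions on \<open>{1..k}\<close>.
\<close>
definition vertex ::
  "complex \<Rightarrow> complex \<Rightarrow> nat \<Rightarrow> nat \<Rightarrow> nat set \<Rightarrow> (nat \<Rightarrow> complex) \<Rightarrow> complex fps" where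
  "vertex q h n k p a =
     Abs_fps (\<lambda>m. \<Sum>d | d \<in> {1..k} \<rightarrow>\<^sub>E UNIV \<and> (\<Sum>j=1..k. d j) = m. vertex_term q h n k p a d)"

definition vertex_on_curve ::
  "complex \<Rightarrow> complex \<Rightarrow> nat \<Rightarrow> nat \<Rightarrow> nat set \<Rightarrow> complex \<Rightarrow> complex fps" where
  "vertex_on_curve q h n k p w = vertex q h n k p (\<lambda>i. w powi (- int i))"

text \<open>The coefficientwise limit \<open>V\<^sub>p(0\<^sub>\<CC>, z)\<close>.\<close>
definition vertex_limit ::
  "complex \<Rightarrow> nat \<Rightarrow> nat \<Rightarrow> nat set \<Rightarrow> complex \<Rightarrow> complex fps" where
  "vertex_limit q n k p h =
     Abs_fps (\<lambda>m. Lim (at 0) (\<lambda>w. fps_nth (vertex_on_curve q h n k p w) m))"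

text \<open>
  A character of the torus \<open>T'\<close> is a multiset of weights; the triple \<open>(\<alpha>, \<beta>, \<gamma>)\<close> stands for the
  monomial \<open>a\<^sub>1'\<^sup>\<alpha> a\<^sub>2'\<^sup>\<beta> \<hbar>'\<^sup>\<gamma>\<close>.
\<close>
type_synonym weight = "int \<times> int \<times> int"

definition dual :: "weight multiset \<Rightarrow> weight multiset" where
  "dual N = image_mset (\<lambda>(\<alpha>, \<beta>, \<gamma>). (- \<alpha>, - \<beta>, - \<gamma>)) N"

text \<open>
  A weight as a power series in \<open>a' = a\<^sub>1'/a\<^sub>2'\<close> (the variable \<open>fps_X\<close>) at a numerical value \<open>h'\<close> of \<open>\<hbar>'\<close>.
  Only the weights \<open>a'\<^sup>\<alpha> \<hbar>'\<^sup>\<gamma>\<close> with \<open>\<alpha> > 0\<close> are such series without constant term.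
\<close>
definition weight_series :: "complex \<Rightarrow> weight \<Rightarrow> complex fps" where
  "weight_series h' = (\<lambda>(\<alpha>, \<beta>, \<gamma>).
     if \<alpha> > 0 \<and> \<beta> = - \<alpha> then fps_const (h' powi \<gamma>) * fps_X ^ nat \<alpha> else undefined)"

definition Xi :: "complex \<Rightarrow> complex \<Rightarrow> complex \<Rightarrow> weight multiset \<Rightarrow> complex fps" where
  "Xi q h' b N = (\<Prod>w\<in>#N. xi q b (weight_series h' w))"

text \<open>
  The \<open>T'\<close>-character \<open>N'\<^sup>-\<^sub>\<lambda>\<close> of the repelling part of the tangent space of the mirror at the
  fixed point \<open>\<lambda>\<close>, which is labelled by the corresponding subset \<open>p\<close>.
\<close>
definition repelling_part :: "nat \<Rightarrow> nat \<Rightarrow> nat set \<Rightarrow> weight multiset" where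
  "repelling_part n k p =
     image_mset (\<lambda>i. (- 1, 1, - 2 * int k + int n - int (elt p i) + 2 * int i)) (mset_set {1..k})"

text \<open>
  The substitution \<open>\<kappa>\<^sup>*\<close>: \<open>z \<mapsto> (a\<^sub>1'/a\<^sub>2') \<hbar>'\<^sup>k\<^sup>-\<^sup>1\<close> and \<open>\<hbar> \<mapsto> q/\<hbar>'\<close>, for a power series in \<open>z\<close> that depends
  on \<open>\<hbar>\<close>; the result is a power series in \<open>a'\<close>.
\<close>
definition kappa_star ::
  "complex \<Rightarrow> nat \<Rightarrow> complex \<Rightarrow> (complex \<Rightarrow> complex fps) \<Rightarrow> complex fps" where
  "kappa_star q k h' F = fps_compose (F (q / h')) (weight_series h' (1, - 1, int k - 1))"

end

theory Submission
  imports Defs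
begin

text \<open>
  On the curve \<open>a\<^sub>i = w\<^sup>-\<^sup>i\<close> each ratio \<open>x = a\<^sub>i/a\<^sub>j\<close> with \<open>i \<noteq> j\<close> tends to \<open>0\<close> or to \<open>\<infinity>\<close>, and
  \<open>(b x)\<^sub>d/(c x)\<^sub>d\<close> then tends to \<open>1\<close> or to \<open>(b/c)\<^sup>d\<close>. Collecting the powers of \<open>\<hbar>/q\<close>, the limit of the
  vertex term factors over the \<open>d\<^sub>i\<close>, so the limit series is a product of \<open>k\<close> series
  \<open>\<Sum> (\<hbar>)\<^sub>d/(q)\<^sub>d u\<^sup>d\<close>. By the \<open>q\<close>-binomial theorem each is \<open>\<phi>(\<hbar>u)/\<phi>(u)\<close>.
\<close>

section \<open>Coefficients of finite products of power series\<close>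

lemma finite_PiE_sum_eq:
  assumes "finite A"
  shows "finite {d \<in> A \<rightarrow>\<^sub>E UNIV. (\<Sum>x\<in>A. d x) = (n::nat)}"
proof (rule finite_subset)
  show "{d \<in> A \<rightarrow>\<^sub>E UNIV. sum d A = n} \<subseteq> A \<rightarrow>\<^sub>E {..n}"
    using assms by (auto simp: PiE_iff extensional_def intro: member_le_sum)
  show "finite (A \<rightarrow>\<^sub>E {..n})"
    using assms by (intro finite_PiE) auto
qed

text \<open>The index set on the right is the one used in \<open>vertex\<close>, so a finite sum of
  terms that factor over the \<open>d j\<close> is recognised as a coefficient of a product of
  series. The induction splits off the exponent of the new element and applies the Cauchy
  product.\<close>

lemma fps_prod_nth_PiE:
  fixes f :: "'a \<Rightarrow> 'b::comm_ring_1 fps"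
  assumes "finite A"
  shows "fps_nth (\<Prod>x\<in>A. f x) n =
           (\<Sum>d | d \<in> A \<rightarrow>\<^sub>E UNIV \<and> (\<Sum>x\<in>A. d x) = n. \<Prod>x\<in>A. fps_nth (f x) (d x))"
  using assms
proof (induction A arbitrary: n rule: finite_induct)
  case empty
  \<comment> \<open>The only extensional function on the empty set is constantly
    \<open>undefined\<close>, and its total is 0.\<close>
  have "{d. d = (\<lambda>x. undefined) \<and> n = 0} = (if n = 0 then {\<lambda>x::'a. undefined::nat} else {})"
    by auto
  thus ?case
    by simp
next
  case (insert a A n)
  let ?D = "\<lambda>A n. {d \<in> A \<rightarrow>\<^sub>E UNIV. (\<Sum>x\<in>A. d x) = (n::nat)}"
  have upd: "(\<Sum>x\<in>A. (g(a := m)) x) = sum g A" for g :: "'a \<Rightarrow> nat" and m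
    using insert.hyps by (intro sum.cong) auto
  have "fps_nth (\<Prod>x\<in>insert a A. f x) n =
          (\<Sum>m=0..n. \<Sum>g\<in>?D A (n - m). fps_nth (f a) m * (\<Prod>x\<in>A. fps_nth (f x) (g x)))"
    using insert by (simp add: fps_mult_nth sum_distrib_left)
  also have "\<dots> = (\<Sum>(m, g)\<in>(SIGMA m:{0..n}. ?D A (n - m)).
                     fps_nth (f a) m * (\<Prod>x\<in>A. fps_nth (f x) (g x)))"
    using insert.hyps by (intro sum.Sigma ballI finite_PiE_sum_eq) auto
  also have "\<dots> = (\<Sum>d\<in>?D (insert a A) n. \<Prod>x\<in>insert a A. fps_nth (f x) (d x))"
  \<comment> \<open>Resetting the value at \<open>a\<close> to \<open>undefined\<close> makes the
    restriction extensional on \<open>A\<close>, so the two maps are mutually inverse.\<close>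
  proof (rule sum.reindex_bij_witness[of _ "\<lambda>d. (d a, d(a := undefined))" "\<lambda>(m, g). g(a := m)"])
    fix d assume "d \<in> ?D (insert a A) n"
    thus "(d a, d(a := undefined)) \<in> (SIGMA m:{0..n}. ?D A (n - m))"
      using insert.hyps upd[of d] by (auto simp: PiE_iff extensional_def)
  next
    fix mg assume mg: "mg \<in> (SIGMA m:{0..n}. ?D A (n - m))"
    then obtain m g where [simp]: "mg = (m, g)" and "m \<le> n" "g \<in> ?D A (n - m)"
      by auto
    show "(case mg of (m, g) \<Rightarrow> g(a := m)) \<in> ?D (insert a A) n"
      using \<open>m \<le> n\<close> \<open>g \<in> _\<close> insert.hyps upd[of g m] by (auto simp: PiE_iff extensional_def)
    have "g a = undefined"
      using \<open>g \<in> _\<close> insert.hyps by (auto simp: PiE_iff extensional_def)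
    thus "(((case mg of (m, g) \<Rightarrow> g(a := m)) a), (case mg of (m, g) \<Rightarrow> g(a := m))(a := undefined)) = mg"
      by auto
    have "(\<Prod>x\<in>A. fps_nth (f x) ((g(a := m)) x)) = (\<Prod>x\<in>A. fps_nth (f x) (g x))"
      using insert.hyps by (intro prod.cong) auto
    thus "(\<Prod>x\<in>insert a A. fps_nth (f x) ((case mg of (m, g) \<Rightarrow> g(a := m)) x)) =
          (case mg of (m, g) \<Rightarrow> fps_nth (f a) m * (\<Prod>x\<in>A. fps_nth (f x) (g x)))"
      using insert.hyps by simp
  qed auto
  finally show ?case .
qed

section \<open>Holomorphy of the infinite product and the q-binomial theorem\<close>

lemma qphi_0 [simp]: "qphi q 0 = 1"
  by (simp add: qphi_def)

text \<open>The partial products converge uniformly on every closed unit disc, by the M-test with a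
  geometric majorant. Holomorphy is what makes the Taylor series in \<open>xi\<close> represent the
  quotient near 0.\<close>

lemma holomorphic_qphi:
  assumes "norm q < 1"
  shows "qphi q holomorphic_on UNIV"
proof (rule holomorphic_uniform_sequence)
  fix x :: complex
  define B where "B = norm x + 1"
  have "uniformly_convergent_on (cball x 1) (\<lambda>N w. \<Sum>n<N. norm (- (w * q ^ n)))"
  proof (rule Weierstrass_m_test')
    fix n w assume "w \<in> cball x 1"
    hence "norm w \<le> B"
      using norm_triangle_ineq2[of w x] by (simp add: B_def dist_norm norm_minus_commute)
    thus "norm (norm (- (w * q ^ n))) \<le> B * norm q ^ n"
      by (simp add: norm_mult norm_power mult_right_mono)
  next
    show "summable (\<lambda>n. B * norm q ^ n)"
      using assms by (intro summable_mult summable_geometric) auto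
  qed
  hence "uniformly_convergent_on (cball x 1) (\<lambda>N w. \<Prod>n<N. 1 + - (w * q ^ n))"
    by (intro uniformly_convergent_on_prod) (auto intro!: continuous_intros)
  then obtain g where g: "uniform_limit (cball x 1) (\<lambda>N w. \<Prod>n<N. 1 - w * q ^ n) g sequentially"
    by (auto simp: uniformly_convergent_on_def)
  have "g w = qphi q w" if "w \<in> cball x 1" for w
  proof (rule LIMSEQ_unique)
    show "(\<lambda>N. \<Prod>n<N. 1 - w * q ^ n) \<longlonglongrightarrow> g w"
      using g that by (rule tendsto_uniform_limitI)
    show "(\<lambda>N. \<Prod>n<N. 1 - w * q ^ n) \<longlonglongrightarrow> qphi q w"
      unfolding qphi_def LIMSEQ_lessThan_iff_atMost
      by (intro convergent_prod_LIMSEQ convergent_prod_qphi assms)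
  qed
  hence "uniform_limit (cball x 1) (\<lambda>N w. \<Prod>n<N. 1 - w * q ^ n) (qphi q) sequentially"
    using g uniform_limit_cong' by (metis (mono_tags, lifting))
  thus "\<exists>d>0. cball x d \<subseteq> UNIV \<and>
          uniform_limit (cball x d) (\<lambda>N w. \<Prod>n<N. 1 - w * q ^ n) (qphi q) sequentially"
    by (intro exI[of _ 1]) auto
qed (auto intro!: holomorphic_intros)

lemma one_minus_power_neq_0:
  fixes q :: "'a::real_normed_div_algebra"
  assumes "norm q < 1" "n > 0"
  shows "1 - q ^ n \<noteq> 0"
proof
  assume "1 - q ^ n = 0"
  hence "norm q ^ n = 1"
    by (metis eq_iff_diff_eq_0 norm_one norm_power)
  moreover have "norm q ^ n < 1"
    using assms by (simp add: power_less_one_iff)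
  ultimately show False
    by simp
qed

lemma qpoch_0_right [simp]: "qpoch q a 0 = 1"
  by (simp add: qpoch_def)

lemma qpoch_Suc: "qpoch q a (int (Suc d)) = qpoch q a (int d) * (1 - a * q ^ d)"
  by (simp add: qpoch_def del: of_nat_Suc)

text \<open>Both sides equal 1 at \<open>d = 0\<close> and obey the same first-order recurrence,
  which comes from the functional equation \<open>qphi_rec\<close>.\<close>

lemma q_binomial:
  assumes "norm q < 1"
  shows "fps_nth (fps_expansion (\<lambda>u. qphi q (b * u) / qphi q u) 0) d =
           qpoch q b (int d) / qpoch q q (int d)"
proof -
  define f where "f = (\<lambda>u. qphi q (b * u) / qphi q u)"
  define F where "F = fps_expansion f 0"
  note hol = holomorphic_qphi[OF assms]
  \<comment> \<open>An open neighbourhood of 0 without zeros of \<phi>, on which the quotient is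
    holomorphic; it contains 0 because \<phi>(0) = 1.\<close>
  define S where "S = qphi q -` (- {0})"
  have "open S"
    unfolding S_def using holomorphic_on_imp_continuous_on[OF hol] by (intro open_vimage) auto
  have "f holomorphic_on S"
  proof -
    have "(\<lambda>u. qphi q (b * u)) holomorphic_on S"
      using holomorphic_on_compose_gen[of "\<lambda>u. b * u" S "qphi q" UNIV] hol
      by (auto simp: o_def intro!: holomorphic_intros)
    thus ?thesis
      unfolding f_def using holomorphic_on_subset[OF hol]
      by (intro holomorphic_intros) (auto simp: S_def)
  qed
  hence F: "f has_fps_expansion F"
    unfolding F_def using \<open>open S\<close> by (intro has_fps_expansion_fps_expansion[of S]) (auto simp: S_def)
  \<comment> \<open>Comparing coefficients in \<open>(1 - u) f(u) = (1 - b u) f(q u)\<close> gives the recurrence of the ratio.\<close>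
  have L: "(\<lambda>u. (1 - u) * f u) has_fps_expansion (1 - fps_X) * F"
    by (intro fps_expansion_intros F)
  have "(f \<circ> (\<lambda>u. q * u)) has_fps_expansion (fps_compose F (fps_const q * fps_X))"
    by (intro has_fps_expansion_compose F fps_expansion_intros) auto
  hence R: "(\<lambda>u. (1 - b * u) * f (q * u)) has_fps_expansion
              (1 - fps_const b * fps_X) * fps_compose F (fps_const q * fps_X)"
    unfolding o_def by (intro fps_expansion_intros)
  have "eventually (\<lambda>u. u \<in> S \<inter> - {1}) (nhds 0)"
    using \<open>open S\<close> by (intro eventually_nhds_in_open) (auto simp: S_def)
  hence "eventually (\<lambda>u. (1 - u) * f u = (1 - b * u) * f (q * u)) (nhds 0)"
  proof eventually_elim
    case (elim u)
    have "qphi q u \<noteq> 0" "u \<noteq> 1"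
      using elim by (auto simp: S_def)
    moreover have "qphi q u = (1 - u) * qphi q (q * u)"
      "qphi q (b * u) = (1 - b * u) * qphi q (b * (q * u))"
      using qphi_rec[OF assms, of u] qphi_rec[OF assms, of "b * u"] by (simp_all add: mult_ac)
    ultimately show ?case
      by (simp add: f_def)
  qed
  \<comment> \<open>The functional equation holds for germs at 0; uniqueness of expansions turns it
    into an identity of formal series.\<close>
  hence "(\<lambda>u. (1 - b * u) * f (q * u)) has_fps_expansion (1 - fps_X) * F"
    using L by (simp only: has_fps_expansion_cong[OF _ refl])
  with R have "(1 - fps_X) * F = (1 - fps_const b * fps_X) * fps_compose F (fps_const q * fps_X)"
    using fps_expansion_unique_complex by blast
  hence eq: "F - fps_X * F = fps_compose F (fps_const q * fps_X) -
               fps_const b * (fps_X * fps_compose F (fps_const q * fps_X))"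
    by (simp only: left_diff_distrib mult_1_left mult.assoc)
  have rec: "fps_nth F (Suc n) * (1 - q ^ Suc n) = fps_nth F n * (1 - b * q ^ n)" for n
  proof -
    have "fps_nth F (Suc n) - fps_nth F n = q ^ Suc n * fps_nth F (Suc n) - b * (q ^ n * fps_nth F n)"
      using arg_cong[OF eq, of "\<lambda>G. fps_nth G (Suc n)"] by simp
    thus ?thesis
      by (simp add: algebra_simps)
  qed
  have "fps_nth F d = qpoch q b (int d) / qpoch q q (int d)"
  proof (induction d)
    case 0
    have "fps_nth F 0 = f 0"
      using F by (rule has_fps_expansion_imp_0_eq_fps_nth_0[symmetric])
    thus ?case
      by (simp add: f_def qpoch_def)
  next
    case (Suc d)
    have "fps_nth F (Suc d) = fps_nth F d * ((1 - b * q ^ d) / (1 - q ^ Suc d))"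
      using rec[of d] one_minus_power_neq_0[OF assms, of "Suc d"] by (simp add: nonzero_eq_divide_eq)
    thus ?case
      by (simp only: Suc qpoch_Suc) simp
  qed
  thus ?thesis
    by (simp add: F_def f_def)
qed

section \<open>Limits of ratios of q-Pochhammer symbols\<close>

lemma tendsto_qpoch_1:
  assumes "(x \<longlongrightarrow> 0) F"
  shows "((\<lambda>w. qpoch q (b * x w) d) \<longlongrightarrow> 1) F"
proof (cases "d \<ge> 0")
  case True
  have "((\<lambda>w. \<Prod>m<nat d. 1 - b * x w * q ^ m) \<longlongrightarrow> (\<Prod>m<nat d. 1 - b * 0 * q ^ m)) F"
    by (intro tendsto_intros assms)
  thus ?thesis
    using True by (simp add: qpoch_def)
next
  case False
  have "((\<lambda>w. 1 / (\<Prod>m=1..nat (-d). 1 - b * x w * q powi (- int m)))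
           \<longlongrightarrow> 1 / (\<Prod>m=1..nat (-d). 1 - b * 0 * q powi (- int m))) F"
    by (intro tendsto_intros assms) auto
  thus ?thesis
    using False by (simp add: qpoch_def)
qed

lemma tendsto_qpoch_ratio_1:
  assumes "(x \<longlongrightarrow> 0) F"
  shows "((\<lambda>w. qpoch q (b * x w) d / qpoch q (c * x w) d) \<longlongrightarrow> 1) F"
  using tendsto_divide[OF tendsto_qpoch_1[OF assms, of q b d] tendsto_qpoch_1[OF assms, of q c d]]
  by simp

lemma tendsto_linear_ratio:
  fixes b c t :: complex
  assumes "filterlim x at_infinity F" "b \<noteq> 0" "c \<noteq> 0" "t \<noteq> 0"
  shows "((\<lambda>w. (1 - b * x w * t) / (1 - c * x w * t)) \<longlongrightarrow> b / c) F"
proof -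
  have inv: "((\<lambda>w. inverse (x w)) \<longlongrightarrow> 0) F"
    using assms(1) tendsto_inverse_0 by (rule filterlim_compose[rotated])
  \<comment> \<open>Numerator and denominator are divided by \<open>x w\<close>, so that only
    \<open>inverse (x w)\<close>, which tends to 0, depends on \<open>w\<close>.\<close>
  have "((\<lambda>w. (inverse (x w) - b * t) / (inverse (x w) - c * t)) \<longlongrightarrow> (0 - b * t) / (0 - c * t)) F"
    using assms by (intro tendsto_intros inv) auto
  moreover have "eventually (\<lambda>w. x w \<noteq> 0) F"
    using assms(1) filterlim_at_infinity_imp_eventually_ne by blast
  hence "eventually (\<lambda>w. (inverse (x w) - b * t) / (inverse (x w) - c * t) =
                          (1 - b * x w * t) / (1 - c * x w * t)) F"
  proof eventually_elim
    case (elim w)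
    have "inverse (x w) - s * t = inverse (x w) * (1 - s * x w * t)" for s
      using elim by (simp add: field_simps)
    thus ?case
      using elim by simp
  qed
  ultimately show ?thesis
    using assms(4) by (simp add: tendsto_cong)
qed

text \<open>Each pair of factors tends to \<open>b / c\<close>, since the powers of \<open>q\<close>
  cancel. For negative \<open>d\<close> the factors stand in denominators, so \<open>- d\<close>
  pairs tend to \<open>c / b\<close> instead.\<close>

lemma tendsto_qpoch_ratio_at_infinity:
  assumes "filterlim x at_infinity F" "b \<noteq> 0" "c \<noteq> 0" "q \<noteq> 0"
  shows "((\<lambda>w. qpoch q (b * x w) d / qpoch q (c * x w) d) \<longlongrightarrow> (b / c) powi d) F"
proof (cases "d \<ge> 0")
  case True
  have "((\<lambda>w. \<Prod>m<nat d. (1 - b * x w * q ^ m) / (1 - c * x w * q ^ m)) \<longlongrightarrow> (\<Prod>m<nat d. b / c)) F"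
    using assms by (intro tendsto_prod tendsto_linear_ratio) auto
  thus ?thesis
    using True by (simp add: qpoch_def prod_dividef power_int_def)
next
  case False
  have "((\<lambda>w. \<Prod>m=1..nat (-d). (1 - c * x w * q powi (- int m)) / (1 - b * x w * q powi (- int m)))
           \<longlongrightarrow> (\<Prod>m=1..nat (-d). c / b)) F"
    using assms by (intro tendsto_prod tendsto_linear_ratio) auto
  thus ?thesis
    using False by (simp add: qpoch_def prod_dividef power_int_def)
qed

section \<open>Coordinate ratios on the curve and the order of the fixed-point labels\<close>

lemma eventually_monomial_ratio:
  "eventually (\<lambda>w::complex. w powi (- int i) / w powi (- int j) = w powi (int j - int i)) (at 0)"
  using eventually_neq_at_within[of "0::complex"]
proof eventually_elim
  case (elim w)
  have "w powi (int j - int i) = w powi (int j) / w powi (int i)"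
    using elim by (intro power_int_diff) auto
  thus ?case
    using elim by (simp add: power_int_minus field_simps)
qed

text \<open>The ratio is \<open>w ^ (j - i)\<close> away from \<open>w = 0\<close>; this is the
  chamber condition that a_i/a_j tends to 0 for i < j.\<close>

lemma tendsto_monomial_ratio:
  assumes "i < j"
  shows "((\<lambda>w::complex. w powi (- int i) / w powi (- int j)) \<longlongrightarrow> 0) (at 0)"
proof -
  have "((\<lambda>w::complex. w ^ (j - i)) \<longlongrightarrow> 0 ^ (j - i)) (at 0)"
    by (intro tendsto_intros)
  moreover have "w powi (int j - int i) = w ^ (j - i)" for w :: complex
    using assms by (simp add: power_int_def nat_diff_distrib')
  ultimately show ?thesis
    using assms tendsto_cong[OF eventually_monomial_ratio[of i j]] by (simp add: zero_power)
qed

lemma filterlim_monomial_ratio_at_infinity: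
  assumes "i > j"
  shows "filterlim (\<lambda>w::complex. w powi (- int i) / w powi (- int j)) at_infinity (at 0)"
proof -
  \<comment> \<open>Non-vanishing upgrades convergence to 0 into a limit in the punctured filter
    \<open>at 0\<close>, as inversion requires.\<close>
  have "eventually (\<lambda>w::complex. w powi (- int j) / w powi (- int i) \<noteq> 0) (at 0)"
    using eventually_neq_at_within[of "0::complex"] by eventually_elim auto
  hence "filterlim (\<lambda>w::complex. w powi (- int j) / w powi (- int i)) (at 0) (at 0)"
    using tendsto_monomial_ratio[OF assms] by (simp add: filterlim_at)
  hence "filterlim (\<lambda>w::complex. inverse (w powi (- int j) / w powi (- int i))) at_infinity (at 0)"
    using filterlim_compose[OF filterlim_inverse_at_infinity] by blast
  thus ?thesis
    by simp
qed

context
  fixes n k :: nat and p :: "nat set"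
  assumes p: "p \<subseteq> {1..n}" "card p = k"
begin

lemma elt_in: "j \<in> {1..k} \<Longrightarrow> elt p j \<in> {1..n}"
proof -
  assume "j \<in> {1..k}"
  moreover have "finite p"
    using p finite_subset by blast
  ultimately have "elt p j \<in> p"
    using nth_mem[of "j - 1" "sorted_list_of_set p"] p by (auto simp: elt_def)
  thus ?thesis
    using p by blast
qed

text \<open>Lets the order of \<open>i\<close> and \<open>j\<close> alone decide whether the ratio
  of the coordinates at \<open>elt p j\<close> and \<open>elt p i\<close> tends to 0 or to
  infinity.\<close>

lemma elt_less: "i \<in> {1..k} \<Longrightarrow> j \<in> {1..k} \<Longrightarrow> i < j \<Longrightarrow> elt p i < elt p j"
  unfolding elt_def using p
  by (intro sorted_wrt_nth_less[of "(<)"]) auto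

end

section \<open>Collecting the powers of h/q\<close>

lemma prod_framing_limits:
  fixes r c :: complex
  assumes "P \<in> {1..n}"
  shows "(\<Prod>i=1..n. if i = P then c else if i < P then 1 else r powi int d) =
           c * (r powi (int n - int P)) ^ d"
proof -
  have "(\<Prod>i=1..n. if i = P then c else if i < P then 1 else r powi int d) =
          c * (\<Prod>i\<in>{1..n} - {P}. if i = P then c else if i < P then 1 else r powi int d)"
    using assms by (subst prod.remove[of _ P]) auto
  \<comment> \<open>Indices below \<open>P\<close> contribute 1, so only the \<open>n - P\<close>
    indices above it remain.\<close>
  also have "(\<Prod>i\<in>{1..n} - {P}. if i = P then c else if i < P then 1 else r powi int d) =
               (\<Prod>i\<in>{P<..n}. r ^ d)"
    using assms by (intro prod.mono_neutral_cong_right) auto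
  also have "\<dots> = (r ^ (n - P)) ^ d"
    by (simp add: mult.commute flip: power_mult)
  finally show ?thesis
    using assms by (simp add: power_int_def nat_diff_distrib')
qed

text \<open>An index \<open>i\<close> is the larger member of \<open>i - 1\<close> pairs and the
  smaller member of \<open>k - i\<close> pairs. It thus collects \<open>r ^ d i\<close> with
  exponent (i - 1) - (k - i) = 2i - k - 1.\<close>

lemma prod_ordered_pairs:
  fixes r :: complex and d :: "nat \<Rightarrow> nat"
  assumes "r \<noteq> 0"
  shows "(\<Prod>i=1..k. \<Prod>j=1..k. if i < j then r powi (int (d j) - int (d i)) else 1) =
           (\<Prod>i=1..k. (r powi (2 * int i - int k - 1)) ^ d i)"
proof -
  have up: "(\<Prod>j=1..k. if i < j then x else 1) = x ^ (k - i)" for i and x :: complex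
  proof -
    have "(\<Prod>j=1..k. if i < j then x else 1) = (\<Prod>j\<in>{i<..k}. x)"
      by (intro prod.mono_neutral_cong_right) auto
    thus ?thesis by simp
  qed
  have down: "(\<Prod>i=1..k. if i < j then x else 1) = x ^ (j - 1)" if "j \<in> {1..k}" for j and x :: complex
  proof -
    have "(\<Prod>i=1..k. if i < j then x else 1) = (\<Prod>i\<in>{1..<j}. x)"
      using that by (intro prod.mono_neutral_cong_right) auto
    thus ?thesis by simp
  qed
  have "r powi (int (d j) - int (d i)) = r ^ d j / r ^ d i" for i j
    using assms power_int_diff[of r "int (d j)" "int (d i)"] by simp
  hence "(\<Prod>i=1..k. \<Prod>j=1..k. if i < j then r powi (int (d j) - int (d i)) else 1) =
        (\<Prod>i=1..k. \<Prod>j=1..k. if i < j then r ^ d j else 1) /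
        (\<Prod>i=1..k. \<Prod>j=1..k. if i < j then r ^ d i else 1)"
    unfolding prod_dividef[symmetric] by (intro prod.cong refl) simp
  \<comment> \<open>Exchanging the products makes \<open>d j\<close> constant in the inner one,
    which then only counts the indices below \<open>j\<close>.\<close>
  also have "(\<Prod>i=1..k. \<Prod>j=1..k. if i < j then r ^ d j else 1) =
             (\<Prod>j=1..k. \<Prod>i=1..k. if i < j then r ^ d j else 1)"
    by (rule prod.swap)
  also have "\<dots> = (\<Prod>j=1..k. (r ^ d j) ^ (j - 1))"
    by (intro prod.cong refl down)
  also have "(\<Prod>i=1..k. \<Prod>j=1..k. if i < j then r ^ d i else 1) = (\<Prod>i=1..k. (r ^ d i) ^ (k - i))"
    by (intro prod.cong refl up)
  also have "(\<Prod>j=1..k. (r ^ d j) ^ (j - 1)) / (\<Prod>i=1..k. (r ^ d i) ^ (k - i)) =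
             (\<Prod>i=1..k. (r powi (2 * int i - int k - 1)) ^ d i)"
    unfolding prod_dividef[symmetric]
  proof (intro prod.cong refl)
    fix i assume "i \<in> {1..k}"
    hence "2 * int i - int k - 1 = int (i - 1) - int (k - i)"
      by auto
    hence "r powi (2 * int i - int k - 1) = r ^ (i - 1) / r ^ (k - i)"
      using assms by (simp only: power_int_diff power_int_of_nat simp_thms)
    thus "(r ^ d i) ^ (i - 1) / (r ^ d i) ^ (k - i) = (r powi (2 * int i - int k - 1)) ^ d i"
      by (simp add: power_divide mult.commute flip: power_mult)
  qed
  finally show ?thesis .
qed

section \<open>The coefficientwise limit of the vertex function\<close>

lemma tendsto_vertex_term:
  fixes q h :: complex
  assumes q: "0 < norm q" "norm q < 1" and "h \<noteq> 0"
    and p: "p \<subseteq> {1..n}" "card p = k"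
  shows "((\<lambda>w. vertex_term q h n k p (\<lambda>i. w powi (- int i)) d) \<longlongrightarrow>
           (\<Prod>i=1..k. ((h / q) powi (int n - int k - int (elt p i) + 2 * int i - 1)) ^ d i *
              (qpoch q h (int (d i)) / qpoch q q (int (d i))))) (at 0)"
proof -
  define r where "r = h / q"
  have "q \<noteq> 0" "r \<noteq> 0"
    using assms by (auto simp: r_def)
  define c where "c = (\<lambda>j. qpoch q h (int (d j)) / qpoch q q (int (d j)))"
  define a where "a = (\<lambda>w i. (w::complex) powi (- int i))"
  have nz: "eventually (\<lambda>w::complex. w \<noteq> 0) (at 0)"
    by (rule eventually_neq_at_within)
  \<comment> \<open>For \<open>i = elt p j\<close> the coordinate ratio is exactly 1 off
    \<open>w = 0\<close>, so this factor keeps its value; the other indices fall under the two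
    asymptotic cases.\<close>
  have 1: "((\<lambda>w. qpoch q (h * (a w i / a w (elt p j))) (int (d j)) /
              qpoch q (q * (a w i / a w (elt p j))) (int (d j)))
            \<longlongrightarrow> (if i = elt p j then c j else if i < elt p j then 1 else r powi int (d j))) (at 0)" for i j
  proof (cases i "elt p j" rule: linorder_cases)
    case equal
    have "eventually (\<lambda>w. a w i / a w (elt p j) = 1) (at 0)"
      using nz by eventually_elim (simp add: a_def equal)
    hence "eventually (\<lambda>w. qpoch q (h * (a w i / a w (elt p j))) (int (d j)) /
              qpoch q (q * (a w i / a w (elt p j))) (int (d j)) = c j) (at 0)"
      by eventually_elim (simp add: c_def)
    thus ?thesis
      using equal by (simp add: tendsto_eventually)
  next
    case less
    thus ?thesis
      using tendsto_qpoch_ratio_1[OF tendsto_monomial_ratio[OF less]] by (simp add: a_def)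
  next
    case greater
    thus ?thesis
      using tendsto_qpoch_ratio_at_infinity[OF filterlim_monomial_ratio_at_infinity[OF greater],
          of h q q "int (d j)"] \<open>h \<noteq> 0\<close> \<open>q \<noteq> 0\<close>
      by (simp add: a_def r_def)
  qed
  \<comment> \<open>The roles of \<open>q\<close> and \<open>h\<close> are exchanged here, so the
    limit at infinity is a power of \<open>q / h\<close>; inverting it reverses the difference of
    the \<open>d\<close>. On the diagonal the difference is 0 and both symbols are 1.\<close>
  have 2: "((\<lambda>w. qpoch q (q * (a w (elt p j) / a w (elt p i))) (int (d i) - int (d j)) /
              qpoch q (h * (a w (elt p j) / a w (elt p i))) (int (d i) - int (d j)))
            \<longlongrightarrow> (if i < j then r powi (int (d j) - int (d i)) else 1)) (at 0)"
    if ij: "i \<in> {1..k}" "j \<in> {1..k}" for i j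
  proof (cases i j rule: linorder_cases)
    case less
    have "(q / h) powi (int (d i) - int (d j)) = r powi (- (int (d i) - int (d j)))"
      unfolding power_int_minus power_int_inverse[symmetric] by (simp add: r_def)
    thus ?thesis
      using less tendsto_qpoch_ratio_at_infinity[OF filterlim_monomial_ratio_at_infinity
          [OF elt_less[OF p ij less]], of q h q "int (d i) - int (d j)"] assms \<open>q \<noteq> 0\<close>
      by (simp add: a_def)
  next
    case greater
    thus ?thesis
      using tendsto_qpoch_ratio_1[OF tendsto_monomial_ratio[OF elt_less[OF p ij(2,1) greater]]]
      by (simp add: a_def)
  qed auto
  have "((\<lambda>w. vertex_term q h n k p (a w) d) \<longlongrightarrow>
      (\<Prod>i=1..n. \<Prod>j=1..k. if i = elt p j then c j else if i < elt p j then 1 else r powi int (d j)) *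
      (\<Prod>i=1..k. \<Prod>j=1..k. if i < j then r powi (int (d j) - int (d i)) else 1)) (at 0)"
    \<comment> \<open>Regroups \<open>h * a i / a j\<close> as \<open>h * (a i / a j)\<close>, the
      form in which 1 and 2 are stated.\<close>
    unfolding vertex_term_def times_divide_eq_right[symmetric]
    by (intro tendsto_mult tendsto_prod 1 2)
  also have "(\<Prod>i=1..n. \<Prod>j=1..k. if i = elt p j then c j else if i < elt p j then 1 else r powi int (d j)) =
    (\<Prod>j=1..k. \<Prod>i=1..n. if i = elt p j then c j else if i < elt p j then 1 else r powi int (d j))"
    by (rule prod.swap)
  also have "\<dots> = (\<Prod>j=1..k. c j * (r powi (int n - int (elt p j))) ^ d j)"
    by (intro prod.cong refl prod_framing_limits elt_in[OF p])
  also have "\<dots> * (\<Prod>i=1..k. \<Prod>j=1..k. if i < j then r powi (int (d j) - int (d i)) else 1) =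
    (\<Prod>i=1..k. (r powi (int n - int k - int (elt p i) + 2 * int i - 1)) ^ d i * c i)"
    unfolding prod_ordered_pairs[OF \<open>r \<noteq> 0\<close>] prod.distrib[symmetric]
  proof (intro prod.cong refl)
    fix i
    \<comment> \<open>The framing factors contribute n - p_i and the ordered pairs 2i - k - 1, which
      add up to the claimed exponent.\<close>
    have "r powi (int n - int k - int (elt p i) + 2 * int i - 1) =
            r powi (int n - int (elt p i)) * r powi (2 * int i - int k - 1)"
      using \<open>r \<noteq> 0\<close> by (subst power_int_add[symmetric]) (auto simp: algebra_simps)
    thus "c i * (r powi (int n - int (elt p i))) ^ d i * (r powi (2 * int i - int k - 1)) ^ d i =
      (r powi (int n - int k - int (elt p i) + 2 * int i - 1)) ^ d i * c i"
      by (simp add: power_mult_distrib)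
  qed
  finally show ?thesis
    by (simp add: a_def c_def r_def)
qed

text \<open>Each coefficient is a finite sum, so limits may be taken termwise. On the right,
  \<open>q_binomial\<close> and the scaling of the variable give the coefficients of each
  factor.\<close>

lemma tendsto_vertex_on_curve:
  fixes q h :: complex
  assumes "0 < norm q" "norm q < 1" "h \<noteq> 0" "p \<subseteq> {1..n}" "card p = k"
  shows "((\<lambda>w. fps_nth (vertex_on_curve q h n k p w) m) \<longlongrightarrow>
           fps_nth (\<Prod>i=1..k. xi q h (fps_const ((h / q) powi
              (int n - int k - int (elt p i) + 2 * int i - 1)) * fps_X)) m) (at 0)"
  unfolding vertex_on_curve_def vertex_def fps_nth_Abs_fps
    fps_prod_nth_PiE[OF finite_atLeastAtMost] xi_def fps_nth_compose_linear q_binomial[OF assms(2)]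
  by (intro tendsto_sum tendsto_vertex_term assms)

section \<open>The mirror substitution and the conclusion\<close>

lemma xi_compose_linear:
  "fps_compose (xi q b (fps_const x * fps_X)) (fps_const y * fps_X) =
     xi q b (fps_const (x * y) * fps_X)"
  unfolding xi_def by (rule fps_ext) (simp only: fps_nth_compose_linear power_mult_distrib mult.assoc mult.left_commute)

text \<open>Convergence is asserted next to the product formula because \<open>Lim\<close> in
  \<open>vertex_limit\<close> has an unspecified value where no limit exists.\<close>

theorem mainTheorem1:
  fixes q :: complex and n k :: nat and p :: "nat set"
  assumes "0 < norm q" and "norm q < 1"
    and "1 \<le> k" and "k \<le> n"
    and "p \<subseteq> {1..n}" and "card p = k"
  shows "(\<forall>h::complex. h \<noteq> 0 \<longrightarrow>
            (\<forall>m. ((\<lambda>w. fps_nth (vertex_on_curve q h n k p w) m)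
                    \<longlongrightarrow> fps_nth (vertex_limit q n k p h) m) (at 0)) \<and>
            vertex_limit q n k p h =
              (\<Prod>i=1..k. xi q h (fps_const ((h / q) powi
                 (int n - int k - int (elt p i) + 2 * int i - 1)) * fps_X))) \<and>
         (n \<ge> 2 * k \<longrightarrow> (\<forall>h'::complex. h' \<noteq> 0 \<longrightarrow>
            kappa_star q k h' (vertex_limit q n k p) =
              Xi q h' (q / h') (dual (repelling_part n k p))))"
proof -
  let ?e = "\<lambda>i. int n - int k - int (elt p i) + 2 * int i - 1"
  have lim: "vertex_limit q n k p h = (\<Prod>i=1..k. xi q h (fps_const ((h / q) powi ?e i) * fps_X))"
    if "h \<noteq> 0" for h
    unfolding vertex_limit_def fps_eq_iff fps_nth_Abs_fps using assms that
    by (intro allI tendsto_Lim tendsto_vertex_on_curve) auto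
  have mirror: "kappa_star q k h' (vertex_limit q n k p) =
                  Xi q h' (q / h') (dual (repelling_part n k p))" if "h' \<noteq> 0" for h'
  proof -
    have "q \<noteq> 0"
      using assms by auto
    \<comment> \<open>Under h = q/h' the base h/q becomes 1/h', which negates the exponent; the
      shift \<open>k - 1\<close> comes from the image of z. The sum is the h'-exponent of the dual
      weight.\<close>
    have weight: "(q / h' / q) powi ?e i * h' powi (int k - 1) =
                    h' powi (2 * int k - int n + int (elt p i) - 2 * int i)" for i
    proof -
      have "(q / h' / q) powi ?e i = h' powi (- ?e i)"
        using \<open>q \<noteq> 0\<close> by (simp only: power_int_minus power_int_inverse[symmetric]) (simp add: field_simps)
      hence "(q / h' / q) powi ?e i * h' powi (int k - 1) = h' powi (- ?e i + (int k - 1))"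
        using that by (subst power_int_add) auto
      also have "- ?e i + (int k - 1) = 2 * int k - int n + int (elt p i) - 2 * int i"
        by simp
      finally show ?thesis .
    qed
    have "kappa_star q k h' (vertex_limit q n k p) =
      fps_compose (\<Prod>i=1..k. xi q (q / h') (fps_const ((q / h' / q) powi ?e i) * fps_X))
        (fps_const (h' powi (int k - 1)) * fps_X)"
      using lim[of "q / h'"] that \<open>q \<noteq> 0\<close> by (simp add: kappa_star_def weight_series_def)
    \<comment> \<open>Composition distributes over the product because the inner series has no
      constant term.\<close>
    also have "\<dots> = (\<Prod>i=1..k. xi q (q / h')
        (fps_const (h' powi (2 * int k - int n + int (elt p i) - 2 * int i)) * fps_X))"
      by (subst fps_compose_prod_distrib) (simp_all only: xi_compose_linear weight, simp)
    \<comment> \<open>Dualising turns the weights (-1, 1, _) into (1, -1, _), so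
      \<open>weight_series\<close> takes its specified branch and never
      \<open>undefined\<close>.\<close>
    also have "\<dots> = Xi q h' (q / h') (dual (repelling_part n k p))"
      by (simp add: Xi_def dual_def repelling_part_def weight_series_def
            multiset.map_comp o_def prod_unfold_prod_mset algebra_simps)
    finally show ?thesis .
  qed
  show ?thesis
    using lim mirror tendsto_vertex_on_curve[OF assms(1,2) _ assms(5,6)] by auto
qed

end
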